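(* Let $\mathcal{X}$ be a real normed linear space, let $\varphi_1,\ldots,\varphi_n\in\mathcal{X}^*$, let $\Phi:\mathcal{X}\to\mathbb{R}^n$ be given by $\Phi(f)=(\varphi_1(f),\ldots,\varphi_n(f))$, let $\langle\cdot,\cdot\rangle_{\mathbb{R}^n}$ be an inner product on $\mathbb{R}^n$ with induced norm $\|\cdot\|_{\mathbb{R}^n}$, and let $\xi\in\mathbb{R}^n$. Then there exists $f\in\mathcal{X}$ such that $$\|\Phi(f)-\xi\|_{\mathbb{R}^n}=\inf_{h\in\mathcal{X}}\|\Phi(h)-\xi\|_{\mathbb{R}^n}.$$ Further, for $f\in\mathcal{X}$, the equality $\|\Phi(f)-\xi\|_{\mathbb{R}^n}=\inf_{h\in\mathcal{X}}\|\Phi(h)-\xi\|_{\mathbb{R}^n}$ holds if and only if $$\Phi^*\Phi(f)=\Phi^*(\xi),$$ where $\Phi^*:\mathbb{R}^n\to\mathcal{X}^*$ is the adjoint of $\Phi$.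
   Context: $\mathcal{X}^*$ denotes the space of all continuous linear functionals on $\mathcal{X}$. The adjoint $\Phi^*:\mathbb{R}^n\to\mathcal{X}^*$ of $\Phi$ (with respect to the fixed inner product $\langle\cdot,\cdot\rangle_{\mathbb{R}^n}$) is the linear operator defined by $(\Phi^*(\mathbf{u}))(f)=\langle\Phi(f),\mathbf{u}\rangle_{\mathbb{R}^n}$ for $f\in\mathcal{X}$, $\mathbf{u}\in\mathbb{R}^n$. $\Phi^*\Phi:\mathcal{X}\to\mathcal{X}^*$ is the composition $f\mapsto\Phi^*(\Phi(f))$. *)

theory Defs
  imports "HOL-Analysis.Analysis"
begin

text \<open>The dual space of \<open>'a\<close> is the type \<open>'a \<Rightarrow>\<^sub>L real\<close> of continuous linear functionals.
  The space \<open>real ^ 'n\<close> carries a standard inner product in the library; here the inner product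
  on it is an arbitrary one, so it is passed around explicitly.\<close>

definition is_inner_product :: "('v::real_vector \<Rightarrow> 'v \<Rightarrow> real) \<Rightarrow> bool" where
  "is_inner_product ip \<longleftrightarrow>
     bilinear ip \<and> (\<forall>x y. ip x y = ip y x) \<and> (\<forall>x. x \<noteq> 0 \<longrightarrow> ip x x > 0)"

definition induced_norm :: "('v \<Rightarrow> 'v \<Rightarrow> real) \<Rightarrow> 'v \<Rightarrow> real" where
  "induced_norm ip x = sqrt (ip x x)"

text \<open>\<open>Blinfun\<close> is meaningful only on bounded linear maps; \<open>adjoint_wrt_apply\<close> below
  shows that this is the case for bounded linear \<open>\<Phi>\<close>.\<close>

definition adjoint_wrt ::
    "(real ^ 'n \<Rightarrow> real ^ 'n \<Rightarrow> real) \<Rightarrow> ('a::real_normed_vector \<Rightarrow> real ^ 'n::finite)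
      \<Rightarrow> real ^ 'n \<Rightarrow> ('a \<Rightarrow>\<^sub>L real)" where
  "adjoint_wrt ip \<Phi> u = Blinfun (\<lambda>f. ip (\<Phi> f) u)"

lemma bounded_linear_vec_blinfun:
  fixes \<phi> :: "'n::finite \<Rightarrow> ('a::real_normed_vector \<Rightarrow>\<^sub>L real)"
  shows "bounded_linear (\<lambda>f. \<chi> i. blinfun_apply (\<phi> i) f)"
proof (rule bounded_linear_intro[where K = "\<Sum>i\<in>UNIV. norm (\<phi> i)"])
  fix f :: 'a
  have "norm (\<chi> i. blinfun_apply (\<phi> i) f) \<le> (\<Sum>i\<in>UNIV. \<bar>blinfun_apply (\<phi> i) f\<bar>)"
    using norm_le_l1_cart[of "\<chi> i. blinfun_apply (\<phi> i) f"] by simp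
  also have "\<dots> \<le> (\<Sum>i\<in>UNIV. norm (\<phi> i) * norm f)"
    by (rule sum_mono) (metis norm_blinfun real_norm_def)
  finally show "norm (\<chi> i. blinfun_apply (\<phi> i) f) \<le> norm f * (\<Sum>i\<in>UNIV. norm (\<phi> i))"
    by (simp add: sum_distrib_left mult.commute)
qed (simp_all add: vec_eq_iff blinfun.add_right blinfun.scaleR_right)

lemma adjoint_wrt_apply:
  assumes "is_inner_product ip" "bounded_linear \<Phi>"
  shows "blinfun_apply (adjoint_wrt ip \<Phi> u) f = ip (\<Phi> f) u"
proof -
  have "bounded_linear (\<lambda>x. ip x u)"
    using assms(1) unfolding is_inner_product_def bilinear_def
    by (simp add: linear_conv_bounded_linear)
  then have "bounded_linear (\<lambda>f. ip (\<Phi> f) u)"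
    using assms(2) by (rule bounded_linear_compose)
  then show ?thesis
    by (simp add: adjoint_wrt_def bounded_linear_Blinfun_apply)
qed

lemma linear_adjoint_wrt:
  assumes "is_inner_product ip" "bounded_linear \<Phi>"
  shows "linear (adjoint_wrt ip \<Phi>)"
proof -
  have "linear (\<lambda>u. ip x u)" for x
    using assms(1) by (simp add: is_inner_product_def bilinear_def)
  then show ?thesis
    by (intro linearI blinfun_eqI)
      (simp_all add: adjoint_wrt_apply[OF assms] blinfun.add_left blinfun.scaleR_left
        linear_add linear_scale)
qed

end

theory Submission imports Defs begin

text \<open>
  The normal equation \<open>\<Phi>\<^sup>* (\<Phi> f) = \<Phi>\<^sup>* \<xi>\<close> says exactly that the residual \<open>\<Phi> f - \<xi>\<close> is
  orthogonal to the range of \<open>\<Phi>\<close> (\<open>adjoint_wrt_eq_iff\<close>). That range is a subspace of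
  \<open>real ^ 'n\<close>, hence finite-dimensional even when the domain of \<open>\<Phi>\<close> is not, and Gram-Schmidt
  provides an orthogonal projection of \<open>\<xi>\<close> onto it (\<open>orthogonal_projection_exists\<close>). So the normal equation has a solution.

  By Pythagoras, if \<open>p\<close> is that projection, the squared distance of a point \<open>w\<close> of the range
  to \<open>\<xi>\<close> exceeds that of \<open>p\<close> by the squared length of \<open>w - p\<close>. Hence \<open>p\<close> is the one and only
  nearest point, and the minimisers are the \<open>f\<close> with \<open>\<Phi> f = p\<close>, which are the
  solutions of the normal equation (\<open>nearest_point_iff_orthogonal\<close>).
\<close>

lemma is_inner_product_simps:
  assumes "is_inner_product ip"
  shows "ip (x + y) z = ip x z + ip y z" "ip (x - y) z = ip x z - ip y z"
    "ip (c *\<^sub>R x) z = c * ip x z"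
    "ip z (x + y) = ip z x + ip z y" "ip z (x - y) = ip z x - ip z y"
    "ip z (c *\<^sub>R x) = c * ip z x"
    "ip 0 z = 0" "ip z 0 = 0"
  using assms unfolding is_inner_product_def
  by (simp_all add: bilinear_ladd bilinear_lsub bilinear_lmul bilinear_radd bilinear_rsub
      bilinear_rmul bilinear_lzero bilinear_rzero)

lemma is_inner_product_commute: "is_inner_product ip \<Longrightarrow> ip x y = ip y x"
  by (simp add: is_inner_product_def)

lemma is_inner_product_nonneg: "is_inner_product ip \<Longrightarrow> 0 \<le> ip x x"
  by (metis is_inner_product_def is_inner_product_simps(7) less_imp_le order_refl)

lemma is_inner_product_le_zero_iff: "is_inner_product ip \<Longrightarrow> ip x x \<le> 0 \<longleftrightarrow> x = 0"
  by (metis is_inner_product_def is_inner_product_simps(7) not_le order_refl)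

lemma is_inner_product_zero_on_span:
  assumes ip: "is_inner_product ip" and "\<And>b. b \<in> B \<Longrightarrow> ip z b = 0" and "w \<in> span B"
  shows "ip z w = 0"
  using assms(3,2)
  by (induction rule: span_induct_alt) (simp_all add: is_inner_product_simps[OF ip])

text \<open>
  This is the Gram-Schmidt process: a new vector \<open>b\<close> contributes, up to sign, the direction
  \<open>e\<close> that is left of \<open>b\<close> after its own projection has been subtracted, and the projection of \<open>x\<close> is corrected
  along \<open>e\<close> alone, which does not disturb orthogonality to the vectors already treated.
\<close>

lemma orthogonal_projection_onto_span_exists:
  assumes ip: "is_inner_product ip" and "finite B"
  shows "\<exists>p\<in>span B. \<forall>w\<in>span B. ip (p - x) w = 0"
  using assms(2)
proof (induction arbitrary: x rule: finite_induct)
  case empty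
  then show ?case by (simp add: is_inner_product_simps[OF ip])
next
  case (insert b B)
  obtain q where q: "q \<in> span B" "\<forall>w\<in>span B. ip (q - b) w = 0"
    using insert.IH by blast
  obtain p where p: "p \<in> span B" "\<forall>w\<in>span B. ip (p - x) w = 0"
    using insert.IH by blast
  define e where "e = q - b"
  \<comment> \<open>If \<open>b\<close> already lies in \<open>span B\<close> then \<open>e = 0\<close>; the quotient by zero is harmless
    since it only multiplies \<open>e\<close>.\<close>
  define p' where "p' = p - (ip (p - x) e / ip e e) *\<^sub>R e"
  have mono: "w \<in> span (insert b B)" if "w \<in> span B" for w
    using that span_mono[of B "insert b B"] by blast
  have "p' \<in> span (insert b B)"
    unfolding p'_def e_def
    by (intro span_diff span_scale mono p q span_base insertI1)
  moreover have e0: "ip (p' - x) e = 0"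
  proof (cases "e = 0")
    case True
    then show ?thesis by (simp add: is_inner_product_simps[OF ip])
  next
    case False
    then have "ip e e \<noteq> 0"
      using is_inner_product_le_zero_iff[OF ip, of e] by auto
    then show ?thesis
      by (simp add: p'_def is_inner_product_simps[OF ip])
  qed
  moreover have B0: "ip (p' - x) w = 0" if "w \<in> span B" for w
    using p(2) q(2) that
    by (simp add: p'_def e_def[symmetric] is_inner_product_simps[OF ip])
  moreover have "ip (p' - x) b = 0"
    using e0 B0[OF q(1)] by (simp add: e_def is_inner_product_simps[OF ip])
  ultimately have "\<forall>w\<in>span (insert b B). ip (p' - x) w = 0"
    using is_inner_product_zero_on_span[OF ip, of "insert b B" "p' - x"]
    by (auto intro: span_base)
  with \<open>p' \<in> span (insert b B)\<close> show ?case by blast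
qed

lemma orthogonal_projection_exists:
  fixes S :: "'v::euclidean_space set"
  assumes "is_inner_product ip" "subspace S"
  shows "\<exists>p\<in>S. \<forall>w\<in>S. ip (p - x) w = 0"
proof -
  obtain B where "finite B" "span B = S"
    by (metis assms(2) basis_subspace_exists)
  then show ?thesis
    using orthogonal_projection_onto_span_exists[OF assms(1)] by blast
qed

lemma induced_norm_le_iff: "induced_norm ip x \<le> induced_norm ip y \<longleftrightarrow> ip x x \<le> ip y y"
  by (simp add: induced_norm_def)

lemma pythagoras_from_projection:
  assumes ip: "is_inner_product ip" and "ip (p - x) (w - p) = 0"
  shows "ip (w - x) (w - x) = ip (p - x) (p - x) + ip (w - p) (w - p)"
proof -
  have "ip ((p - x) + (w - p)) ((p - x) + (w - p))
      = ip (p - x) (p - x) + ip (w - p) (w - p) + 2 * ip (p - x) (w - p)"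
    unfolding is_inner_product_simps(1,4)[OF ip]
    using is_inner_product_commute[OF ip, of "w - p" "p - x"] by simp
  then show ?thesis using assms(2) by simp
qed

text \<open>
  That a nearest point is orthogonal is usually shown by varying it along a line. Here it follows
  from the existence of a projection \<open>p\<close>: Pythagoras forces every nearest point to equal \<open>p\<close>.
\<close>

lemma nearest_point_iff_orthogonal:
  fixes S :: "'v::euclidean_space set"
  assumes ip: "is_inner_product ip" and S: "subspace S" and y: "y \<in> S"
  shows "(\<forall>w\<in>S. induced_norm ip (y - x) \<le> induced_norm ip (w - x)) \<longleftrightarrow>
         (\<forall>w\<in>S. ip (y - x) w = 0)"
proof
  assume orth: "\<forall>w\<in>S. ip (y - x) w = 0"
  show "\<forall>w\<in>S. induced_norm ip (y - x) \<le> induced_norm ip (w - x)"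
  proof
    fix w assume "w \<in> S"
    then have "ip (y - x) (w - y) = 0"
      using orth subspace_diff[OF S _ y] by blast
    from pythagoras_from_projection[OF ip this]
    show "induced_norm ip (y - x) \<le> induced_norm ip (w - x)"
      using is_inner_product_nonneg[OF ip, of "w - y"] by (simp add: induced_norm_le_iff)
  qed
next
  assume nearest: "\<forall>w\<in>S. induced_norm ip (y - x) \<le> induced_norm ip (w - x)"
  obtain p where p: "p \<in> S" "\<forall>w\<in>S. ip (p - x) w = 0"
    using orthogonal_projection_exists[OF ip S] by blast
  have "ip (p - x) (y - p) = 0"
    using p subspace_diff[OF S y] by blast
  from pythagoras_from_projection[OF ip this]
  have "ip (y - p) (y - p) \<le> 0"
    using nearest p(1) by (auto simp: induced_norm_le_iff)
  then have "y = p"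
    using is_inner_product_le_zero_iff[OF ip] by auto
  with p(2) show "\<forall>w\<in>S. ip (y - x) w = 0" by simp
qed

lemma adjoint_wrt_eq_iff:
  assumes "is_inner_product ip" "bounded_linear \<Phi>"
  shows "adjoint_wrt ip \<Phi> u = adjoint_wrt ip \<Phi> v \<longleftrightarrow> (\<forall>w\<in>range \<Phi>. ip (u - v) w = 0)"
proof -
  have "adjoint_wrt ip \<Phi> u = adjoint_wrt ip \<Phi> v \<longleftrightarrow> (\<forall>f. ip (\<Phi> f) u = ip (\<Phi> f) v)"
    by (metis adjoint_wrt_apply[OF assms] blinfun_eqI)
  also have "\<dots> \<longleftrightarrow> (\<forall>w\<in>range \<Phi>. ip w (u - v) = 0)"
    by (simp add: is_inner_product_simps[OF assms(1)])
  finally show ?thesis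
    by (simp add: is_inner_product_commute[OF assms(1), of "u - v"])
qed

lemma eq_INF_iff_minimiser:
  fixes g :: "'b \<Rightarrow> 'c::conditionally_complete_lattice"
  assumes "bdd_below (range g)"
  shows "g f = (INF h. g h) \<longleftrightarrow> (\<forall>h. g f \<le> g h)"
proof
  assume "g f = (INF h. g h)"
  then show "\<forall>h. g f \<le> g h"
    using cINF_lower[OF assms] by simp
next
  assume "\<forall>h. g f \<le> g h"
  then show "g f = (INF h. g h)"
    by (intro antisym cINF_greatest cINF_lower[OF assms]) auto
qed

theorem theorem3p9:
  fixes \<phi> :: "'n::finite \<Rightarrow> ('a::real_normed_vector \<Rightarrow>\<^sub>L real)"
    and ip :: "real ^ 'n \<Rightarrow> real ^ 'n \<Rightarrow> real"
    and \<xi> :: "real ^ 'n"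
    and \<Phi> :: "'a \<Rightarrow> real ^ 'n"
  assumes "is_inner_product ip"
    and "\<Phi> = (\<lambda>f. \<chi> i. blinfun_apply (\<phi> i) f)"
  shows "(\<exists>f. induced_norm ip (\<Phi> f - \<xi>) = (INF h. induced_norm ip (\<Phi> h - \<xi>))) \<and>
         (\<forall>f. induced_norm ip (\<Phi> f - \<xi>) = (INF h. induced_norm ip (\<Phi> h - \<xi>)) \<longleftrightarrow>
              (adjoint_wrt ip \<Phi> \<circ> \<Phi>) f = adjoint_wrt ip \<Phi> \<xi>)"
proof -
  have bl: "bounded_linear \<Phi>"
    unfolding assms(2) by (rule bounded_linear_vec_blinfun)
  have S: "subspace (range \<Phi>)"
    using bl by (simp add: bounded_linear.linear linear_subspace_image)
  have "bdd_below (range (\<lambda>h. induced_norm ip (\<Phi> h - \<xi>)))"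
    by (rule bdd_belowI2[where m = 0])
      (simp add: induced_norm_def is_inner_product_nonneg[OF assms(1)])
  note INF_iff = eq_INF_iff_minimiser[OF this]
  have orth: "induced_norm ip (\<Phi> f - \<xi>) = (INF h. induced_norm ip (\<Phi> h - \<xi>)) \<longleftrightarrow>
      (\<forall>w\<in>range \<Phi>. ip (\<Phi> f - \<xi>) w = 0)" for f
    unfolding INF_iff
    using nearest_point_iff_orthogonal[OF assms(1) S, of "\<Phi> f" \<xi>] by simp
  have "\<exists>f. \<forall>w\<in>range \<Phi>. ip (\<Phi> f - \<xi>) w = 0"
    using orthogonal_projection_exists[OF assms(1) S, of \<xi>] by blast
  then show ?thesis
    unfolding orth by (simp add: adjoint_wrt_eq_iff[OF assms(1) bl])
qed

end
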